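(* Let $H$ be a Hilbert space of dimension $n<\infty$, let $H_1,\dots,H_m$ be Hilbert spaces with $\dim H_j=l_j<\infty$, and put $l=\sum_{j=1}^m l_j$. Let $V_j\in B(H,H_j)$, $j=1,\dots,m$, regarded as $l_j\times n$ matrices with respect to fixed orthonormal bases. Then $\{V_j\}_{j=1}^m$ is a Parseval (OPV)-frame for $H$ if and only if there exist matrices $V_1',V_2',\dots,V_m'$, where $V_j'$ is an $l_j\times(l-n)$ matrix, such that $\{[V_j,V_j']\}_{j=1}^m$ is an orthonormal (OPV)-frame.
   Context: Hilbert spaces are over $\mathbb{R}$ or $\mathbb{C}$; $B(H,K)$ denotes the bounded linear operators from $H$ to $K$. A family $V_j\in B(H,H_j)$, $j=1,\dots,m$, is an operator-valued frame ((OPV)-frame) for $H$ if there are constants $A,B>0$ with $AI\le\sum_{j=1}^m V_j^*V_j\le BI$; it is Parseval if $\sum_{j=1}^m V_j^*V_j=I$. Its analysis operator is $\theta_V:H\to\bigoplus_{j=1}^m H_j$, $\theta_V x=(V_jx)_{j=1}^m$, i.e. the $l\times n$ matrix obtained by stacking $V_1,\dots,V_m$ vertically. An (OPV)-frame with $\mathrm{Range}(V_j)=H_j$ for all $j$ is Riesz if $\mathrm{Range}(\theta_V)=\bigoplus_j H_j$, and it is called orthonormal if it is Riesz and Parseval; equivalently, $\theta_V$ is unitary. Here $[V_j,V_j']$ denotes the $l_j\times l$ matrix obtained by placing $V_j'$ to the right of $V_j$, regarded as an operator from an $l$-dimensional Hilbert space to $H_j$. *)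

theory Defs
  imports
    "HOL-Analysis.Analysis"
    "Jordan_Normal_Form.VS_Connect"
    "Jordan_Normal_Form.Conjugate"
begin

section \<open>Scalars\<close>

text \<open>
  The scalar field is the reals or the complex numbers. A real normed field is isometrically
  isomorphic to one of the two (Gelfand--Mazur); the two axioms below then force the conjugation
  and the partial order to be the standard ones (on the complex numbers,
  a \<open>\<le>\<close> b means that b - a is a nonnegative real). So there are no models besides the two
  instances.
\<close>

class real_or_complex = real_normed_field + conjugatable_ordered_field +
  assumes mult_conjugate_eq_norm: "x * conjugate x = (norm x)\<^sup>2 *\<^sub>R 1"
    and zero_le_iff_scaleR: "0 \<le> x \<longleftrightarrow> (\<exists>r\<ge>0. x = r *\<^sub>R 1)"

instance real :: real_or_complex
  by standard (auto simp: power2_eq_square)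

instance complex :: real_or_complex
proof
  fix x :: complex
  show "x * conjugate x = (norm x)\<^sup>2 *\<^sub>R 1"
    using complex_norm_square[of x] by (simp add: scaleR_conv_of_real)
  show "0 \<le> x \<longleftrightarrow> (\<exists>r\<ge>0. x = r *\<^sub>R 1)"
    by (auto simp: less_eq_complex_def complex_eq_iff)
qed


section \<open>Hilbert spaces and bounded operators\<close>

text \<open>The fields \<open>mult\<close> and \<open>one\<close> inherited from the library record of modules play no role.\<close>

record ('k, 'v) hilbert = "('k, 'v) module" +
  inner_prod :: "'v \<Rightarrow> 'v \<Rightarrow> 'k"

definition hnorm :: "('k::real_or_complex, 'v) hilbert \<Rightarrow> 'v \<Rightarrow> real" where
  "hnorm H x = sqrt (norm (inner_prod H x x))"

locale hilbert_space = vectorspace class_ring H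
  for H :: "('k::real_or_complex, 'v) hilbert" +
  assumes inner_add_left:
      "\<lbrakk>x \<in> carrier H; y \<in> carrier H; z \<in> carrier H\<rbrakk> \<Longrightarrow>
        inner_prod H (x \<oplus>\<^bsub>H\<^esub> y) z = inner_prod H x z + inner_prod H y z"
    and inner_smult_left:
      "\<lbrakk>x \<in> carrier H; y \<in> carrier H\<rbrakk> \<Longrightarrow>
        inner_prod H (c \<odot>\<^bsub>H\<^esub> x) y = c * inner_prod H x y"
    and inner_conjugate:
      "\<lbrakk>x \<in> carrier H; y \<in> carrier H\<rbrakk> \<Longrightarrow>
        inner_prod H y x = conjugate (inner_prod H x y)"
    and inner_nonneg: "x \<in> carrier H \<Longrightarrow> 0 \<le> inner_prod H x x"
    and inner_definite: "\<lbrakk>x \<in> carrier H; inner_prod H x x = 0\<rbrakk> \<Longrightarrow> x = \<zero>\<^bsub>H\<^esub>"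
    and complete:
      "\<lbrakk>\<And>i. X i \<in> carrier H;
        \<forall>\<epsilon>>0. \<exists>N. \<forall>i\<ge>N. \<forall>j\<ge>N. hnorm H (X i \<ominus>\<^bsub>H\<^esub> X j) < \<epsilon>\<rbrakk> \<Longrightarrow>
        \<exists>x\<in>carrier H. (\<lambda>i. hnorm H (X i \<ominus>\<^bsub>H\<^esub> x)) \<longlonglongrightarrow> 0"

text \<open>
  The library's \<open>dim\<close> is meaningful only for finitely generated spaces.
\<close>

definition has_dim :: "('k::real_or_complex, 'v) hilbert \<Rightarrow> nat \<Rightarrow> bool" where
  "has_dim H n \<longleftrightarrow> vectorspace.fin_dim class_ring H \<and> vectorspace.dim class_ring H = n"

definition orthonormal_basis ::
    "('k::real_or_complex, 'v) hilbert \<Rightarrow> nat \<Rightarrow> (nat \<Rightarrow> 'v) \<Rightarrow> bool" where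
  "orthonormal_basis H n e \<longleftrightarrow>
     (\<forall>i<n. e i \<in> carrier H) \<and>
     (\<forall>i<n. \<forall>k<n. inner_prod H (e i) (e k) = (if i = k then 1 else 0)) \<and>
     LinearCombinations.module.span class_ring H (e ` {..<n}) = carrier H"

text \<open>
  Operators are HOL functions that matter only on the carrier of their domain.
\<close>

definition bounded_ops ::
    "('k::real_or_complex, 'v) hilbert \<Rightarrow> ('k, 'w) hilbert \<Rightarrow> ('v \<Rightarrow> 'w) set" where
  "bounded_ops H K =
     {T \<in> LinearCombinations.module_hom class_ring H K.
        \<exists>C. \<forall>x\<in>carrier H. hnorm K (T x) \<le> C * hnorm H x}"

definition adj ::
    "('k::real_or_complex, 'v) hilbert \<Rightarrow> ('k, 'w) hilbert \<Rightarrow> ('v \<Rightarrow> 'w) \<Rightarrow> 'w \<Rightarrow> 'v" where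
  "adj H K T = (SOME S. S \<in> bounded_ops K H \<and>
     (\<forall>x\<in>carrier H. \<forall>y\<in>carrier K. inner_prod K (T x) y = inner_prod H x (S y)))"

definition op_le ::
    "('k::real_or_complex, 'v) hilbert \<Rightarrow> ('v \<Rightarrow> 'v) \<Rightarrow> ('v \<Rightarrow> 'v) \<Rightarrow> bool" where
  "op_le H S T \<longleftrightarrow>
     (\<forall>x\<in>carrier H. inner_prod H (S x) x \<le> inner_prod H (T x) x)"


section \<open>Operator-valued frames\<close>

text \<open>
  A family \<open>V 1, \<dots>, V m\<close> of operators from \<open>H\<close> to \<open>Hs 1, \<dots>, Hs m\<close>; the spaces \<open>Hs j\<close> have
  their own carriers and operations and need not be related to each other.
\<close>

definition frame_op ::
    "('k::real_or_complex, 'v) hilbert \<Rightarrow> nat \<Rightarrow> (nat \<Rightarrow> ('k, 'w) hilbert) \<Rightarrow>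
     (nat \<Rightarrow> 'v \<Rightarrow> 'w) \<Rightarrow> 'v \<Rightarrow> 'v" where
  "frame_op H m Hs V x = (\<Oplus>\<^bsub>H\<^esub>j\<in>{1..m}. adj H (Hs j) (V j) (V j x))"

definition opv_frame ::
    "('k::real_or_complex, 'v) hilbert \<Rightarrow> nat \<Rightarrow> (nat \<Rightarrow> ('k, 'w) hilbert) \<Rightarrow>
     (nat \<Rightarrow> 'v \<Rightarrow> 'w) \<Rightarrow> bool" where
  "opv_frame H m Hs V \<longleftrightarrow>
     (\<forall>j\<in>{1..m}. V j \<in> bounded_ops H (Hs j)) \<and>
     (\<exists>A B :: real. 0 < A \<and> 0 < B \<and>
        op_le H (\<lambda>x. of_real A \<odot>\<^bsub>H\<^esub> x) (frame_op H m Hs V) \<and>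
        op_le H (frame_op H m Hs V) (\<lambda>x. of_real B \<odot>\<^bsub>H\<^esub> x))"

definition parseval_frame ::
    "('k::real_or_complex, 'v) hilbert \<Rightarrow> nat \<Rightarrow> (nat \<Rightarrow> ('k, 'w) hilbert) \<Rightarrow>
     (nat \<Rightarrow> 'v \<Rightarrow> 'w) \<Rightarrow> bool" where
  "parseval_frame H m Hs V \<longleftrightarrow>
     opv_frame H m Hs V \<and> (\<forall>x\<in>carrier H. frame_op H m Hs V x = x)"

definition analysis_op :: "nat \<Rightarrow> (nat \<Rightarrow> 'v \<Rightarrow> 'w) \<Rightarrow> 'v \<Rightarrow> nat \<Rightarrow> 'w" where
  "analysis_op m V x = (\<lambda>j\<in>{1..m}. V j x)"

definition riesz_frame ::
    "('k::real_or_complex, 'v) hilbert \<Rightarrow> nat \<Rightarrow> (nat \<Rightarrow> ('k, 'w) hilbert) \<Rightarrow>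
     (nat \<Rightarrow> 'v \<Rightarrow> 'w) \<Rightarrow> bool" where
  "riesz_frame H m Hs V \<longleftrightarrow>
     opv_frame H m Hs V \<and>
     (\<forall>j\<in>{1..m}. V j ` carrier H = carrier (Hs j)) \<and>
     analysis_op m V ` carrier H = (\<Pi>\<^sub>E j\<in>{1..m}. carrier (Hs j))"

definition orthonormal_frame ::
    "('k::real_or_complex, 'v) hilbert \<Rightarrow> nat \<Rightarrow> (nat \<Rightarrow> ('k, 'w) hilbert) \<Rightarrow>
     (nat \<Rightarrow> 'v \<Rightarrow> 'w) \<Rightarrow> bool" where
  "orthonormal_frame H m Hs V \<longleftrightarrow> riesz_frame H m Hs V \<and> parseval_frame H m Hs V"


section \<open>Operators and matrices\<close>

text \<open>
  Matrix of an operator from \<open>H\<close> (orthonormal basis \<open>e\<close> of length \<open>n\<close>) to \<open>K\<close> (orthonormal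
  basis \<open>f\<close> of length \<open>d\<close>), and conversely. The inner product is linear in its first argument,
  so the \<open>i\<close>-th coordinate of \<open>y\<close> is \<open>inner_prod K y (f i)\<close>.
\<close>

definition mat_of_op ::
    "nat \<Rightarrow> (nat \<Rightarrow> 'v) \<Rightarrow> ('k::real_or_complex, 'w) hilbert \<Rightarrow> nat \<Rightarrow> (nat \<Rightarrow> 'w) \<Rightarrow>
     ('v \<Rightarrow> 'w) \<Rightarrow> 'k mat" where
  "mat_of_op n e K d f T = mat d n (\<lambda>(i, k). inner_prod K (T (e k)) (f i))"

definition op_of_mat ::
    "('k::real_or_complex, 'v) hilbert \<Rightarrow> (nat \<Rightarrow> 'v) \<Rightarrow> ('k, 'w) hilbert \<Rightarrow> (nat \<Rightarrow> 'w) \<Rightarrow>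
     'k mat \<Rightarrow> 'v \<Rightarrow> 'w" where
  "op_of_mat H e K f A x =
     (\<Oplus>\<^bsub>K\<^esub>i\<in>{..<dim_row A}. (\<Sum>k<dim_col A. A $$ (i, k) * inner_prod H x (e k)) \<odot>\<^bsub>K\<^esub> f i)"

text \<open>The block matrix [A, B] for matrices with the same number of rows.\<close>

definition beside :: "'k mat \<Rightarrow> 'k mat \<Rightarrow> 'k mat" where
  "beside A B = mat_of_cols (dim_row A) (cols A @ cols B)"

end

theory Submission
  imports Defs
begin

text \<open>
  In coordinates, the family is Parseval if and only if the columns of the matrix obtained by
  stacking the matrices of the operators are orthonormal. Its rows are indexed by the pairs
  \<open>(j, i)\<close> with \<open>i < l j\<close>, so there are \<open>L\<close> of them. An orthonormal system of \<open>n\<close> columns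
  extends to one of \<open>L\<close> columns, and the new columns, cut into blocks, are the matrices \<open>V' j\<close>.
  Conversely, the first \<open>n\<close> columns of an orthonormal system are orthonormal.
\<close>

section \<open>Conjugation and norms of scalars\<close>

text \<open>Conjugation is known only through the class axioms; for nonzero \<open>r\<close> the
  claim comes from cancelling \<open>of_real r\<close> in the axiom on
  \<open>x * conjugate x\<close>.\<close>

lemma conjugate_of_real [simp]: "conjugate (of_real r :: 'k::real_or_complex) = of_real r"
proof (cases "r = 0")
  case False
  have "of_real r * conjugate (of_real r :: 'k) = of_real r * of_real r"
    using mult_conjugate_eq_norm[of "of_real r :: 'k"]
    by (simp add: scaleR_conv_of_real power2_eq_square flip: of_real_mult)
  with False show ?thesis by simp
qed simp

lemma mult_conjugate: "x * conjugate x = of_real ((norm x)\<^sup>2)" for x :: "'k::real_or_complex"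
  by (simp only: mult_conjugate_eq_norm scaleR_conv_of_real mult_1_right)


section \<open>Orthonormal systems of coordinate vectors\<close>

text \<open>
  The conjugated vectors are the rows of a square matrix that has a zero row as well, hence a
  nonzero kernel vector.
\<close>

lemma ex_orthogonal_vector:
  fixes u :: "nat \<Rightarrow> 'i \<Rightarrow> 'k::real_or_complex"
  assumes I: "finite I" and n: "n < card I"
  shows "\<exists>w. (\<exists>p\<in>I. w p \<noteq> 0) \<and> (\<forall>k<n. (\<Sum>p\<in>I. w p * conjugate (u k p)) = 0)"
proof -
  define N where "N = card I"
  from I obtain b where b: "bij_betw b {..<N} I"
    using ex_bij_betw_nat_finite[of I] unfolding N_def lessThan_atLeast0 by blast
  \<comment> \<open>Row \<open>n\<close> exists because \<open>n < N\<close>, and it makes the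
    matrix singular. The rows after it hold further values of \<open>u\<close>; only the equations
    from the rows before \<open>n\<close> are read off.\<close>
  define A where "A = mat\<^sub>r N N (\<lambda>k. if k = n then 0\<^sub>v N else vec N (\<lambda>i. conjugate (u k (b i))))"
  have A: "A \<in> carrier_mat N N" by (simp add: A_def)
  have "det A = 0" unfolding A_def using n by (intro det_row_0) (auto simp: N_def)
  then obtain v where v: "v \<in> carrier_vec N" "v \<noteq> 0\<^sub>v N" "A *\<^sub>v v = 0\<^sub>v N"
    using det_0_iff_vec_prod_zero_field[OF A] by auto
  define w where "w p = v $ (inv_into {..<N} b p)" for p
  have wb: "w (b i) = v $ i" if "i < N" for i
    using that bij_betw_inv_into_left[OF b] by (simp add: w_def)
  from v(1,2) obtain i where i: "i < N" "v $ i \<noteq> 0" by (auto simp: vec_eq_iff)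
  have "b i \<in> I" using b i by (auto simp: bij_betw_def)
  moreover have "w (b i) \<noteq> 0" using wb i by simp
  moreover have "(\<Sum>p\<in>I. w p * conjugate (u k p)) = 0" if k: "k < n" for k
  proof -
    have "0 = (A *\<^sub>v v) $ k" using v(3) k n by (simp add: N_def)
    also have "\<dots> = (\<Sum>i<N. conjugate (u k (b i)) * v $ i)"
      using k n v(1) by (auto simp: A_def scalar_prod_def N_def lessThan_atLeast0 intro!: sum.cong)
    also have "\<dots> = (\<Sum>i<N. w (b i) * conjugate (u k (b i)))"
      by (intro sum.cong) (auto simp: wb mult.commute)
    also have "\<dots> = (\<Sum>p\<in>I. w p * conjugate (u k p))"
      by (rule sum.reindex_bij_betw[OF b])
    finally show ?thesis by simp
  qed
  ultimately show ?thesis by blast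
qed

text \<open>Divide an orthogonal vector by its norm: the factor is real, so conjugation fixes it and
  the squared norm is multiplied by its square.\<close>

lemma ex_unit_orthogonal_vector:
  fixes u :: "nat \<Rightarrow> 'i \<Rightarrow> 'k::real_or_complex"
  assumes I: "finite I" and n: "n < card I"
  shows "\<exists>w. (\<Sum>p\<in>I. w p * conjugate (w p)) = 1 \<and>
    (\<forall>k<n. (\<Sum>p\<in>I. w p * conjugate (u k p)) = 0)"
proof -
  obtain w where w: "\<exists>p\<in>I. w p \<noteq> 0" "\<forall>k<n. (\<Sum>p\<in>I. w p * conjugate (u k p)) = 0"
    using ex_orthogonal_vector[OF assms] by blast
  define r where "r = (\<Sum>p\<in>I. (norm (w p))\<^sup>2)"
  have r: "r > 0" unfolding r_def using I w(1)
    by (auto intro!: sum_pos2)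
  define c :: 'k where "c = of_real (1 / sqrt r)"
  have cc: "conjugate c = c" unfolding c_def by (rule conjugate_of_real)
  have "(\<Sum>p\<in>I. (c * w p) * conjugate (c * w p)) = c * c * (\<Sum>p\<in>I. w p * conjugate (w p))"
    by (simp add: conjugate_dist_mul cc sum_distrib_left mult_ac)
  also have "(\<Sum>p\<in>I. w p * conjugate (w p)) = of_real r"
    by (simp add: mult_conjugate r_def)
  also have "c * c * of_real r = 1"
    using r by (simp add: c_def flip: of_real_mult)
  finally have "(\<Sum>p\<in>I. (c * w p) * conjugate (c * w p)) = 1" .
  moreover have "(\<Sum>p\<in>I. (c * w p) * conjugate (u k p)) = 0" if "k < n" for k
    using w(2) that by (simp add: mult.assoc flip: sum_distrib_left)
  ultimately show ?thesis by (intro exI[of _ "\<lambda>p. c * w p"]) simp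
qed

text \<open>Vectors are functions on an arbitrary index set, so that the rows of a stacked matrix
  can be indexed by pairs without being renumbered; \<open>u k\<close> is its column
  \<open>k\<close>.\<close>

definition orthonormal_system :: "'i set \<Rightarrow> nat \<Rightarrow> (nat \<Rightarrow> 'i \<Rightarrow> 'k::real_or_complex) \<Rightarrow> bool" where
  "orthonormal_system I n u \<longleftrightarrow>
     (\<forall>k<n. \<forall>k'<n. (\<Sum>p\<in>I. u k p * conjugate (u k' p)) = (if k = k' then 1 else 0))"

lemma orthonormal_system_mono:
  "orthonormal_system I n u \<Longrightarrow> n' \<le> n \<Longrightarrow> orthonormal_system I n' u"
  by (auto simp: orthonormal_system_def)

lemma orthonormal_system_cong:
  assumes "\<And>k p. k < n \<Longrightarrow> p \<in> I \<Longrightarrow> u k p = v k p"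
  shows "orthonormal_system I n u \<longleftrightarrow> orthonormal_system I n v"
  using assms by (simp add: orthonormal_system_def)

text \<open>As long as there are fewer vectors than indices, a unit vector orthogonal to all of them
  can be appended.\<close>

lemma orthonormal_system_extend:
  fixes u :: "nat \<Rightarrow> 'i \<Rightarrow> 'k::real_or_complex"
  assumes I: "finite I" and n: "n \<le> N" "N \<le> card I" and u: "orthonormal_system I n u"
  shows "\<exists>v. orthonormal_system I N v \<and> (\<forall>k<n. v k = u k)"
  using n
proof (induction N rule: dec_induct)
  case base
  then show ?case using u by blast
next
  case (step N)
  then obtain v where v: "orthonormal_system I N v" "\<forall>k<n. v k = u k" by auto
  obtain w where w: "(\<Sum>p\<in>I. w p * conjugate (w p)) = 1"
      "\<forall>k<N. (\<Sum>p\<in>I. w p * conjugate (v k p)) = 0"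
    using ex_unit_orthogonal_vector[OF I, of N v] step by auto
  \<comment> \<open>The definition ranges over ordered pairs, so orthogonality is also needed with
    the new vector in the second slot.\<close>
  have w': "(\<Sum>p\<in>I. v k p * conjugate (w p)) = 0" if "k < N" for k
  proof -
    have "(\<Sum>p\<in>I. v k p * conjugate (w p)) = conjugate (\<Sum>p\<in>I. w p * conjugate (v k p))"
      by (simp add: sum_conjugate[OF I] conjugate_dist_mul mult.commute)
    then show ?thesis using w(2) that by simp
  qed
  have "orthonormal_system I (Suc N) (v(N := w))"
    using v(1) w w' by (auto simp: orthonormal_system_def less_Suc_eq)
  moreover have "\<forall>k<n. (v(N := w)) k = u k" using v(2) step by auto
  ultimately show ?case by blast
qed

text \<open>A left inverse of a square matrix is a right inverse.\<close>

lemma orthonormal_system_dual: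
  fixes u :: "nat \<Rightarrow> 'i \<Rightarrow> 'k::real_or_complex"
  assumes I: "finite I" and u: "orthonormal_system I (card I) u" and p: "p \<in> I" and q: "q \<in> I"
  shows "(\<Sum>k<card I. u k p * conjugate (u k q)) = (if p = q then 1 else 0)"
proof -
  define N where "N = card I"
  from I obtain b where b: "bij_betw b {..<N} I"
    using ex_bij_betw_nat_finite[of I] unfolding N_def lessThan_atLeast0 by blast
  define A where "A = mat N N (\<lambda>(k, i). u k (b i))"
  define B where "B = mat N N (\<lambda>(i, k). conjugate (u k (b i)))"
  have A: "A \<in> carrier_mat N N" and B: "B \<in> carrier_mat N N" by (simp_all add: A_def B_def)
  have "A * B = 1\<^sub>m N"
  proof (rule eq_matI)
    fix k k' assume k: "k < dim_row (1\<^sub>m N :: 'k mat)" "k' < dim_col (1\<^sub>m N :: 'k mat)"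
    then have "(A * B) $$ (k, k') = (\<Sum>i<N. u k (b i) * conjugate (u k' (b i)))"
      by (auto simp: A_def B_def scalar_prod_def lessThan_atLeast0 intro!: sum.cong)
    also have "\<dots> = (\<Sum>p\<in>I. u k p * conjugate (u k' p))"
      by (rule sum.reindex_bij_betw[OF b])
    also have "\<dots> = 1\<^sub>m N $$ (k, k')"
      using u k by (simp add: orthonormal_system_def N_def)
    finally show "(A * B) $$ (k, k') = 1\<^sub>m N $$ (k, k')" .
  qed (simp_all add: A_def B_def)
  then have BA: "B * A = 1\<^sub>m N" by (rule mat_mult_left_right_inverse[OF A B])
  obtain i j where ij: "i < N" "j < N" "p = b i" "q = b j"
    using p q b by (auto simp: bij_betw_def)
  \<comment> \<open>The conjugates sit in \<open>B\<close>, so the conjugated index \<open>q\<close>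
    selects the row of the product and \<open>p\<close> its column.\<close>
  have "(\<Sum>k<N. u k p * conjugate (u k q)) = (B * A) $$ (j, i)"
    using ij by (auto simp: A_def B_def scalar_prod_def lessThan_atLeast0 mult.commute intro!: sum.cong)
  also have "\<dots> = (if p = q then 1 else 0)"
    using ij b by (auto simp: BA bij_betw_def inj_on_def)
  finally show ?thesis by (simp add: N_def)
qed

text \<open>Otherwise the first \<open>card I\<close> vectors already form a unitary matrix. The
  next vector expands in them with coefficients that vanish by orthogonality, so it is zero,
  although its norm is 1.\<close>

lemma orthonormal_system_card_le:
  fixes u :: "nat \<Rightarrow> 'i \<Rightarrow> 'k::real_or_complex"
  assumes I: "finite I" and u: "orthonormal_system I n u"
  shows "n \<le> card I"
proof (rule ccontr)
  let ?N = "card I"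
  assume "\<not> n \<le> ?N"
  then have N: "?N < n" by simp
  have "u ?N q = 0" if q: "q \<in> I" for q
  proof -
    have dual: "(\<Sum>k<?N. conjugate (u k p) * u k q) = (if q = p then 1 else 0)" if "p \<in> I" for p
      using orthonormal_system_dual[OF I orthonormal_system_mono[OF u] q that] N
      by (simp add: mult.commute)
    \<comment> \<open>Writing the entry as a sum against a Kronecker delta lets \<open>dual\<close>
      introduce the expansion in the first \<open>?N\<close> vectors.\<close>
    have "u ?N q = (\<Sum>p\<in>I. if p = q then u ?N p else 0)" using I q by simp
    also have "\<dots> = (\<Sum>p\<in>I. u ?N p * (\<Sum>k<?N. conjugate (u k p) * u k q))"
      by (intro sum.cong) (auto simp only: dual mult_1_right mult_zero_right split: if_splits)
    also have "\<dots> = (\<Sum>k<?N. (\<Sum>p\<in>I. u ?N p * conjugate (u k p)) * u k q)"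
      unfolding sum_distrib_left sum_distrib_right
      by (subst sum.swap) (simp add: mult_ac)
    also have "\<dots> = 0"
    proof (rule sum.neutral, safe)
      fix k assume "k < ?N"
      then have "(\<Sum>p\<in>I. u ?N p * conjugate (u k p)) = 0"
        using u N by (simp add: orthonormal_system_def)
      then show "(\<Sum>p\<in>I. u ?N p * conjugate (u k p)) * u k q = 0" by simp
    qed
    finally show ?thesis .
  qed
  then have "(\<Sum>p\<in>I. u ?N p * conjugate (u ?N p)) = 0" by simp
  then show False using u N by (simp add: orthonormal_system_def)
qed


section \<open>Hilbert spaces in coordinates\<close>

context hilbert_space
begin

lemma scale_closed [simp, intro]: "x \<in> carrier H \<Longrightarrow> c \<odot>\<^bsub>H\<^esub> x \<in> carrier H"
  by (rule smult_closed) simp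

lemma inner_zero_left [simp]: "y \<in> carrier H \<Longrightarrow> inner_prod H \<zero>\<^bsub>H\<^esub> y = 0"
  using inner_smult_left[of y y 0] smult_l_null[of y] by simp

lemma inner_sum_left:
  assumes "\<And>i. i \<in> A \<Longrightarrow> x i \<in> carrier H" and "y \<in> carrier H"
  shows "inner_prod H (\<Oplus>\<^bsub>H\<^esub>i\<in>A. x i) y = (\<Sum>i\<in>A. inner_prod H (x i) y)"
  using assms(1)
proof (induction A rule: infinite_finite_induct)
  case (insert i A)
  then have "finsum H x (insert i A) = x i \<oplus>\<^bsub>H\<^esub> finsum H x A"
    by (intro finsum_insert) auto
  moreover have "finsum H x A \<in> carrier H" using insert by (intro finsum_closed) auto
  ultimately show ?case using insert assms(2) by (simp add: inner_add_left)
\<comment> \<open>Over an infinite index set both sums take the default value zero.\<close>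
qed (use assms(2) in simp_all)

lemma hnorm_nonneg: "0 \<le> hnorm H x"
  by (simp add: hnorm_def)

end

section \<open>Coordinates with respect to an orthonormal basis\<close>

locale onb_space = hilbert_space H
  for H :: "('k::real_or_complex, 'v) hilbert" +
  fixes n :: nat and e :: "nat \<Rightarrow> 'v"
  assumes onb: "orthonormal_basis H n e"
begin

abbreviation coord :: "'v \<Rightarrow> nat \<Rightarrow> 'k" where
  "coord x k \<equiv> inner_prod H x (e k)"

lemma basis_closed [simp]: "k < n \<Longrightarrow> e k \<in> carrier H"
  using onb by (simp add: orthonormal_basis_def)

lemma coord_basis: "k < n \<Longrightarrow> k' < n \<Longrightarrow> coord (e k) k' = (if k = k' then 1 else 0)"
  using onb by (simp add: orthonormal_basis_def)

definition of_coords :: "(nat \<Rightarrow> 'k) \<Rightarrow> 'v" where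
  "of_coords c = (\<Oplus>\<^bsub>H\<^esub>k\<in>{..<n}. c k \<odot>\<^bsub>H\<^esub> e k)"

lemma of_coords_closed [simp]: "of_coords c \<in> carrier H"
  unfolding of_coords_def by (rule finsum_closed) auto

lemma inner_of_coords: "y \<in> carrier H \<Longrightarrow> inner_prod H (of_coords c) y = (\<Sum>k<n. c k * inner_prod H (e k) y)"
  unfolding of_coords_def by (subst inner_sum_left) (auto simp: inner_smult_left intro!: sum.cong)

lemma coord_of_coords:
  assumes "k < n"
  shows "coord (of_coords c) k = c k"
proof -
  have "coord (of_coords c) k = (\<Sum>k'<n. if k' = k then c k' else 0)"
    unfolding inner_of_coords[OF basis_closed[OF assms]]
    using assms by (intro sum.cong) (auto simp: coord_basis)
  then show ?thesis using assms by simp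
qed

text \<open>The vector is a linear combination of basis vectors; expanding the left slot of its
  inner product with itself gives 0, and definiteness applies.\<close>

lemma orthogonal_basis_imp_zero:
  assumes y: "y \<in> carrier H" and 0: "\<And>k. k < n \<Longrightarrow> coord y k = 0"
  shows "y = \<zero>\<^bsub>H\<^esub>"
proof -
  have "y \<in> span (e ` {..<n})" using onb y by (simp add: orthonormal_basis_def)
  then obtain a A where A: "A \<subseteq> e ` {..<n}" "y = lincomb a A" unfolding span_def by blast
  have AC: "v \<in> carrier H" if "v \<in> A" for v using A that by auto
  have ev: "inner_prod H v y = 0" if v: "v \<in> A" for v
  proof -
    obtain k where "k < n" "v = e k" using A v by auto
    then show ?thesis using inner_conjugate[of y v] 0[of k] y by simp
  qed
  have "inner_prod H (lincomb a A) y = (\<Sum>v\<in>A. a v * inner_prod H v y)"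
    using AC y unfolding lincomb_def by (simp add: inner_sum_left inner_smult_left)
  then have "inner_prod H y y = 0" using ev by (simp flip: A(2))
  then show ?thesis using inner_definite y by blast
qed

lemma eq_if_coord_eq:
  assumes x: "x \<in> carrier H" and y: "y \<in> carrier H" and eq: "\<And>k. k < n \<Longrightarrow> coord x k = coord y k"
  shows "x = y"
proof -
  let ?z = "x \<oplus>\<^bsub>H\<^esub> (- 1) \<odot>\<^bsub>H\<^esub> y"
  have "?z = \<zero>\<^bsub>H\<^esub>"
    using x y eq by (intro orthogonal_basis_imp_zero) (simp_all add: inner_add_left inner_smult_left)
  \<comment> \<open>The same lemma shows that \<open>(- 1)\<close> times \<open>y\<close> is the
    additive inverse of \<open>y\<close>, so cancelling on the right yields
    \<open>x = y\<close>.\<close>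
  moreover have "y \<oplus>\<^bsub>H\<^esub> (- 1) \<odot>\<^bsub>H\<^esub> y = \<zero>\<^bsub>H\<^esub>"
    using y by (intro orthogonal_basis_imp_zero) (simp_all add: inner_add_left inner_smult_left)
  ultimately show ?thesis using x y
    by (metis add.right_cancel scale_closed)
qed

lemma of_coords_coord: "x \<in> carrier H \<Longrightarrow> of_coords (coord x) = x"
  by (rule eq_if_coord_eq) (simp_all add: coord_of_coords)

text \<open>Expand only the left argument in the basis; conjugate symmetry turns the remaining
  factors into coordinates of \<open>y\<close>.\<close>

lemma inner_coord:
  assumes "x \<in> carrier H" and "y \<in> carrier H"
  shows "inner_prod H x y = (\<Sum>k<n. coord x k * conjugate (coord y k))"
proof -
  have "inner_prod H x y = inner_prod H (of_coords (coord x)) y"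
    using assms by (simp add: of_coords_coord)
  also have "\<dots> = (\<Sum>k<n. coord x k * inner_prod H (e k) y)"
    using assms by (simp add: inner_of_coords)
  also have "\<dots> = (\<Sum>k<n. coord x k * conjugate (coord y k))"
    using assms by (intro sum.cong) (simp_all add: inner_conjugate[of y])
  finally show ?thesis .
qed

lemma hnorm_coord:
  assumes "x \<in> carrier H"
  shows "hnorm H x = sqrt (\<Sum>k<n. (norm (coord x k))\<^sup>2)"
proof -
  have "inner_prod H x x = of_real (\<Sum>k<n. (norm (coord x k))\<^sup>2)"
    using inner_coord[OF assms assms] by (simp add: mult_conjugate)
  then show ?thesis by (simp add: hnorm_def sum_nonneg del: of_real_sum)
qed

lemma norm_coord_le:
  assumes "x \<in> carrier H" and "k < n"
  shows "norm (coord x k) \<le> hnorm H x"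
proof -
  have "(norm (coord x k))\<^sup>2 \<le> (\<Sum>k<n. (norm (coord x k))\<^sup>2)"
    using assms(2) by (intro member_le_sum) auto
  then show ?thesis using assms(1) by (simp add: hnorm_coord real_le_rsqrt)
qed

end

section \<open>Matrices, bounded operators and adjoints\<close>

locale onb_pair = dom: onb_space H n e + cod: onb_space K d f
  for H :: "('k::real_or_complex, 'v) hilbert" and n e and K :: "('k, 'w) hilbert" and d f
begin

lemma
  assumes A: "A \<in> carrier_mat d n"
  shows op_of_mat_closed: "op_of_mat H e K f A x \<in> carrier K"
    and coord_op_of_mat:
      "i < d \<Longrightarrow> cod.coord (op_of_mat H e K f A x) i = (\<Sum>k<n. A $$ (i, k) * dom.coord x k)"
proof -
  have eq: "op_of_mat H e K f A x = cod.of_coords (\<lambda>i. \<Sum>k<n. A $$ (i, k) * dom.coord x k)"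
    using A by (auto simp: op_of_mat_def cod.of_coords_def)
  show "op_of_mat H e K f A x \<in> carrier K" by (simp add: eq)
  show "i < d \<Longrightarrow> cod.coord (op_of_mat H e K f A x) i = (\<Sum>k<n. A $$ (i, k) * dom.coord x k)"
    by (simp add: eq cod.coord_of_coords)
qed

lemma op_of_mat_bounded:
  assumes A: "A \<in> carrier_mat d n"
  shows "op_of_mat H e K f A \<in> bounded_ops H K"
proof -
  let ?T = "op_of_mat H e K f A"
  note closed = op_of_mat_closed[OF A] and co = coord_op_of_mat[OF A]
  have "?T (x \<oplus>\<^bsub>H\<^esub> y) = ?T x \<oplus>\<^bsub>K\<^esub> ?T y" if "x \<in> carrier H" "y \<in> carrier H" for x y
    using that by (intro cod.eq_if_coord_eq)
      (simp_all add: closed co cod.inner_add_left dom.inner_add_left distrib_left sum.distrib)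
  moreover have "?T (c \<odot>\<^bsub>H\<^esub> x) = c \<odot>\<^bsub>K\<^esub> ?T x" if "x \<in> carrier H" for c x
    using that by (intro cod.eq_if_coord_eq)
      (simp_all add: closed co cod.inner_smult_left dom.inner_smult_left sum_distrib_left mult_ac)
  ultimately have hom: "?T \<in> module_hom class_ring H K"
    by (auto simp: module_hom_def closed)
  \<comment> \<open>Each coordinate of the image is at most the absolute row sum times the norm of
    \<open>x\<close>; \<open>C\<close> is the Euclidean norm of the vector of these row
    sums.\<close>
  define C where "C = sqrt (\<Sum>i<d. (\<Sum>k<n. norm (A $$ (i, k)))\<^sup>2)"
  have "hnorm K (?T x) \<le> C * hnorm H x" if x: "x \<in> carrier H" for x
  proof -
    have "norm (cod.coord (?T x) i) \<le> (\<Sum>k<n. norm (A $$ (i, k))) * hnorm H x" if "i < d" for i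
    proof -
      have "norm (cod.coord (?T x) i) \<le> (\<Sum>k<n. norm (A $$ (i, k) * dom.coord x k))"
        unfolding co[OF that] by (rule norm_sum)
      also have "\<dots> \<le> (\<Sum>k<n. norm (A $$ (i, k)) * hnorm H x)"
        by (intro sum_mono) (auto simp: norm_mult intro!: mult_left_mono dom.norm_coord_le[OF x])
      finally show ?thesis by (simp add: sum_distrib_right)
    qed
    then have "(\<Sum>i<d. (norm (cod.coord (?T x) i))\<^sup>2)
        \<le> (\<Sum>i<d. ((\<Sum>k<n. norm (A $$ (i, k))) * hnorm H x)\<^sup>2)"
      by (intro sum_mono power_mono) auto
    also have "\<dots> = (C * hnorm H x)\<^sup>2"
      by (simp add: C_def power_mult_distrib sum_nonneg flip: sum_distrib_right)
    finally have "hnorm K (?T x) \<le> sqrt ((C * hnorm H x)\<^sup>2)"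
      unfolding cod.hnorm_coord[OF closed] by (rule real_sqrt_le_mono)
    also have "\<dots> = C * hnorm H x"
      by (simp add: C_def sum_nonneg dom.hnorm_nonneg)
    finally show ?thesis .
  qed
  then show ?thesis using hom by (auto simp: bounded_ops_def)
qed

text \<open>By linearity an operator is determined by the images of the basis vectors, that is, by
  its matrix.\<close>

lemma coord_op:
  assumes T: "T \<in> bounded_ops H K" and x: "x \<in> carrier H" and i: "i < d"
  shows "cod.coord (T x) i = (\<Sum>k<n. dom.coord x k * cod.coord (T (e k)) i)"
proof -
  have hom: "T \<in> module_hom class_ring H K" using T by (simp add: bounded_ops_def)
  interpret T: mod_hom class_ring H K T by unfold_locales (rule hom)
  have TC: "T y \<in> carrier K" if "y \<in> carrier H" for y using that by (rule T.f_im)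
  have Tsum: "T (finsum H y B) = (\<Oplus>\<^bsub>K\<^esub>k\<in>B. T (y k))" if "\<And>k. k \<in> B \<Longrightarrow> y k \<in> carrier H"
    for B :: "nat set" and y
    using that
  proof (induction B rule: infinite_finite_induct)
    case (insert k B)
    then have "finsum H y (insert k B) = y k \<oplus>\<^bsub>H\<^esub> finsum H y B"
      by (intro dom.finsum_insert) auto
    moreover have "(\<Oplus>\<^bsub>K\<^esub>k\<in>insert k B. T (y k)) = T (y k) \<oplus>\<^bsub>K\<^esub> (\<Oplus>\<^bsub>K\<^esub>k\<in>B. T (y k))"
      using insert by (intro cod.finsum_insert) (auto intro: TC)
    moreover have "finsum H y B \<in> carrier H" using insert by (intro dom.finsum_closed) auto
    ultimately show ?case using insert by simp
  qed simp_all
  have "T x = T (\<Oplus>\<^bsub>H\<^esub>k\<in>{..<n}. dom.coord x k \<odot>\<^bsub>H\<^esub> e k)"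
    using dom.of_coords_coord[OF x] by (simp add: dom.of_coords_def)
  also have "\<dots> = (\<Oplus>\<^bsub>K\<^esub>k\<in>{..<n}. T (dom.coord x k \<odot>\<^bsub>H\<^esub> e k))" by (rule Tsum) auto
  finally have "cod.coord (T x) i = (\<Sum>k<n. cod.coord (T (dom.coord x k \<odot>\<^bsub>H\<^esub> e k)) i)"
    using i by (simp only:) (rule cod.inner_sum_left, auto intro: TC)
  also have "\<dots> = (\<Sum>k<n. dom.coord x k * cod.coord (T (e k)) i)"
    using i by (intro sum.cong) (simp_all add: TC cod.inner_smult_left)
  finally show ?thesis .
qed

lemma op_closed: "T \<in> bounded_ops H K \<Longrightarrow> x \<in> carrier H \<Longrightarrow> T x \<in> carrier K"
  by (auto simp: bounded_ops_def module_hom_def)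

text \<open>Since \<open>adj\<close> is a choice, its properties follow once some operator has them.
  The operator of the conjugate transpose does.\<close>

lemma
  assumes T: "T \<in> bounded_ops H K"
  shows adj_bounded: "adj H K T \<in> bounded_ops K H"
    and inner_adj: "x \<in> carrier H \<Longrightarrow> y \<in> carrier K \<Longrightarrow>
      inner_prod K (T x) y = inner_prod H x (adj H K T y)"
proof -
  \<comment> \<open>The same facts with the two spaces exchanged serve the operators from
    \<open>K\<close> to \<open>H\<close>.\<close>
  interpret KH: onb_pair K d f H n e ..
  let ?P = "\<lambda>S. S \<in> bounded_ops K H \<and>
     (\<forall>x\<in>carrier H. \<forall>y\<in>carrier K. inner_prod K (T x) y = inner_prod H x (S y))"
  define A where "A = mat n d (\<lambda>(k, i). conjugate (cod.coord (T (e k)) i))"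
  define S where "S = op_of_mat K f H e A"
  have A: "A \<in> carrier_mat n d" by (simp add: A_def)
  have S: "S \<in> bounded_ops K H" unfolding S_def by (rule KH.op_of_mat_bounded[OF A])
  have "inner_prod K (T x) y = inner_prod H x (S y)" if x: "x \<in> carrier H" and y: "y \<in> carrier K" for x y
  proof -
    have S_coord: "conjugate (dom.coord (S y) k) =
        (\<Sum>i<d. cod.coord (T (e k)) i * conjugate (cod.coord y i))" if "k < n" for k
      unfolding S_def KH.coord_op_of_mat[OF A that]
      using that by (simp add: A_def sum_conjugate conjugate_dist_mul)
    have "inner_prod K (T x) y = (\<Sum>i<d. cod.coord (T x) i * conjugate (cod.coord y i))"
      by (rule cod.inner_coord[OF op_closed[OF T x] y])
    also have "\<dots> = (\<Sum>i<d. \<Sum>k<n. dom.coord x k * (cod.coord (T (e k)) i * conjugate (cod.coord y i)))"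
      by (intro sum.cong) (simp_all add: coord_op[OF T x] sum_distrib_right mult.assoc)
    also have "\<dots> = (\<Sum>k<n. dom.coord x k * conjugate (dom.coord (S y) k))"
      by (subst sum.swap, rule sum.cong[OF refl]) (simp only: S_coord lessThan_iff sum_distrib_left)
    also have "\<dots> = inner_prod H x (S y)"
      by (rule dom.inner_coord[OF x KH.op_closed[OF S y], symmetric])
    finally show ?thesis .
  qed
  with S have "?P S" by blast
  then have P: "?P (adj H K T)" unfolding adj_def by (rule someI[of ?P])
  then show "adj H K T \<in> bounded_ops K H" by blast
  show "x \<in> carrier H \<Longrightarrow> y \<in> carrier K \<Longrightarrow>
      inner_prod K (T x) y = inner_prod H x (adj H K T y)" using P by blast
qed

end


section \<open>Frames in coordinates\<close>

text \<open>The frame operator is the adjoint of the analysis operator composed with it, so its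
  matrix is the Gram matrix of the stacked columns; it is the identity exactly when these are
  orthonormal.\<close>

lemma parseval_frame_iff:
  fixes H :: "('k::real_or_complex, 'v) hilbert" and Hs :: "nat \<Rightarrow> ('k, 'w) hilbert"
  assumes H: "onb_space H n e"
    and Hs: "\<And>j. j \<in> {1..m} \<Longrightarrow> onb_space (Hs j) (l j) (f j)"
    and V: "\<And>j. j \<in> {1..m} \<Longrightarrow> V j \<in> bounded_ops H (Hs j)"
  shows "parseval_frame H m Hs V \<longleftrightarrow>
    orthonormal_system (SIGMA j:{1..m}. {..<l j}) n
      (\<lambda>k (j, i). inner_prod (Hs j) (V j (e k)) (f j i))"
    (is "_ \<longleftrightarrow> orthonormal_system ?I n ?u")
proof -
  interpret H: onb_space H n e by (rule H)
  have pair: "onb_pair H n e (Hs j) (l j) (f j)" if "j \<in> {1..m}" for j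
    by (intro onb_pair.intro H Hs that)
  have adjC: "adj H (Hs j) (V j) (V j x) \<in> carrier H" if "j \<in> {1..m}" "x \<in> carrier H" for j x
  proof -
    interpret onb_pair H n e "Hs j" "l j" "f j" by (rule pair[OF that(1)])
    interpret KH: onb_pair "Hs j" "l j" "f j" H n e ..
    show ?thesis using KH.op_closed[OF adj_bounded op_closed] V[OF that(1)] that(2) by blast
  qed
  have FC: "frame_op H m Hs V x \<in> carrier H" if "x \<in> carrier H" for x
    unfolding frame_op_def using adjC that by (intro H.finsum_closed) auto
  \<comment> \<open>This is the inner product of the stacked coordinates of all \<open>V j x\<close>
    with column \<open>k'\<close>: the adjoints are moved across and each inner product is taken in
    coordinates.\<close>
  have coord_frame: "H.coord (frame_op H m Hs V x) k' =
      (\<Sum>(j, i)\<in>?I. inner_prod (Hs j) (V j x) (f j i) * conjugate (?u k' (j, i)))"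
    if x: "x \<in> carrier H" and k': "k' < n" for x k'
  proof -
    have "inner_prod H (adj H (Hs j) (V j) (V j x)) (e k') =
        (\<Sum>i<l j. inner_prod (Hs j) (V j x) (f j i) * conjugate (?u k' (j, i)))"
      if j: "j \<in> {1..m}" for j
    proof -
      interpret onb_pair H n e "Hs j" "l j" "f j" by (rule pair[OF j])
      have "inner_prod H (adj H (Hs j) (V j) (V j x)) (e k') =
          conjugate (inner_prod H (e k') (adj H (Hs j) (V j) (V j x)))"
        using adjC[OF j x] k' by (intro H.inner_conjugate) auto
      also have "\<dots> = conjugate (inner_prod (Hs j) (V j (e k')) (V j x))"
        using V[OF j] x k' by (simp add: inner_adj op_closed)
      also have "\<dots> = inner_prod (Hs j) (V j x) (V j (e k'))"
        using V[OF j] x k' by (intro cod.inner_conjugate[symmetric] op_closed) auto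
      also have "\<dots> = (\<Sum>i<l j. inner_prod (Hs j) (V j x) (f j i) * conjugate (?u k' (j, i)))"
        using cod.inner_coord[OF op_closed[OF V[OF j] x] op_closed[OF V[OF j] H.basis_closed[OF k']]]
        by simp
      finally show ?thesis .
    qed
    moreover have "H.coord (frame_op H m Hs V x) k' =
        (\<Sum>j\<in>{1..m}. inner_prod H (adj H (Hs j) (V j) (V j x)) (e k'))"
      unfolding frame_op_def using adjC x k' by (intro H.inner_sum_left) auto
    ultimately have "H.coord (frame_op H m Hs V x) k' =
        (\<Sum>j\<in>{1..m}. \<Sum>i<l j. inner_prod (Hs j) (V j x) (f j i) * conjugate (?u k' (j, i)))"
      by simp
    then show ?thesis by (simp add: sum.Sigma)
  qed
  show ?thesis
  proof
    assume "parseval_frame H m Hs V"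
    then have F: "frame_op H m Hs V x = x" if "x \<in> carrier H" for x
      using that by (simp add: parseval_frame_def)
    show "orthonormal_system ?I n ?u"
      unfolding orthonormal_system_def
    proof (intro allI impI)
      fix k k' assume k: "k < n" "k' < n"
      have "(\<Sum>p\<in>?I. ?u k p * conjugate (?u k' p)) = H.coord (frame_op H m Hs V (e k)) k'"
        using k by (auto simp: coord_frame intro!: sum.cong)
      also have "\<dots> = (if k = k' then 1 else 0)" using k by (simp add: F H.coord_basis)
      finally show "(\<Sum>p\<in>?I. ?u k p * conjugate (?u k' p)) = (if k = k' then 1 else 0)" .
    qed
  next
    assume u: "orthonormal_system ?I n ?u"
    have F: "frame_op H m Hs V x = x" if x: "x \<in> carrier H" for x
    proof (rule H.eq_if_coord_eq[OF FC[OF x] x])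
      fix k' assume k': "k' < n"
      \<comment> \<open>The stacked coordinates of \<open>x\<close> are the combination of the
        columns with the coordinates of \<open>x\<close> as coefficients.\<close>
      have "H.coord (frame_op H m Hs V x) k' =
          (\<Sum>p\<in>?I. (\<Sum>k<n. H.coord x k * ?u k p) * conjugate (?u k' p))"
        unfolding coord_frame[OF x k']
      proof (rule sum.cong[OF refl])
        fix p assume "p \<in> ?I"
        then obtain j i where p: "p = (j, i)" and j: "j \<in> {1..m}" and i: "i < l j" by auto
        interpret onb_pair H n e "Hs j" "l j" "f j" by (rule pair[OF j])
        show "(case p of (j, i) \<Rightarrow> inner_prod (Hs j) (V j x) (f j i) * conjugate (?u k' (j, i))) =
            (\<Sum>k<n. H.coord x k * ?u k p) * conjugate (?u k' p)"
          using coord_op[OF V[OF j] x i] by (simp add: p)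
      qed
      also have "\<dots> = (\<Sum>k<n. H.coord x k * (\<Sum>p\<in>?I. ?u k p * conjugate (?u k' p)))"
        unfolding sum_distrib_left sum_distrib_right by (subst sum.swap) (simp add: mult_ac)
      also have "\<dots> = (\<Sum>k<n. if k = k' then H.coord x k else 0)"
        using u k' by (intro sum.cong) (auto simp: orthonormal_system_def)
      also have "\<dots> = H.coord x k'" using k' by simp
      finally show "H.coord (frame_op H m Hs V x) k' = H.coord x k'" .
    qed
    have one: "of_real 1 \<odot>\<^bsub>H\<^esub> x = x" if "x \<in> carrier H" for x
      using H.smult_one[OF that] by simp
    have "opv_frame H m Hs V"
      \<comment> \<open>As the frame operator is the identity, both frame bounds can be 1.\<close>
      unfolding opv_frame_def op_le_def using V F one
      by (intro conjI exI[of _ "1 :: real"]) auto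
    then show "parseval_frame H m Hs V" using F by (simp add: parseval_frame_def)
  qed
qed

text \<open>
  Since the stacked matrix is square, orthonormal columns make it unitary, hence
  surjective.
\<close>

lemma riesz_frame_if_parseval:
  fixes K :: "('k::real_or_complex, 'u) hilbert" and Hs :: "nat \<Rightarrow> ('k, 'w) hilbert"
  assumes K: "onb_space K (\<Sum>j=1..m. l j) g"
    and Hs: "\<And>j. j \<in> {1..m} \<Longrightarrow> onb_space (Hs j) (l j) (f j)"
    and W: "\<And>j. j \<in> {1..m} \<Longrightarrow> W j \<in> bounded_ops K (Hs j)"
    and parseval: "parseval_frame K m Hs W"
  shows "riesz_frame K m Hs W"
proof -
  define L where "L = (\<Sum>j=1..m. l j)"
  interpret K: onb_space K L g using K by (simp add: L_def)
  have pair: "onb_pair K L g (Hs j) (l j) (f j)" if "j \<in> {1..m}" for j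
    by (intro onb_pair.intro Hs that) unfold_locales
  let ?I = "SIGMA j:{1..m}. {..<l j}"
  let ?u = "\<lambda>k (j, i). inner_prod (Hs j) (W j (g k)) (f j i)"
  have fin: "finite ?I" by simp
  have card: "card ?I = L" by (simp add: L_def)
  have u: "orthonormal_system ?I (card ?I) ?u"
    using parseval parseval_frame_iff[OF K Hs W] by (simp add: card L_def)
  have WC: "W j x \<in> carrier (Hs j)" if "j \<in> {1..m}" "x \<in> carrier K" for j x
    using onb_pair.op_closed[OF pair W] that by blast
  have surj: "\<exists>x\<in>carrier K. \<forall>j\<in>{1..m}. W j x = y j"
    if y: "\<And>j. j \<in> {1..m} \<Longrightarrow> y j \<in> carrier (Hs j)" for y
  proof
    define c where "c = (\<lambda>(j, i). inner_prod (Hs j) (y j) (f j i))"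
    \<comment> \<open>The preimage is the adjoint of the stacked matrix applied to the stacked
      coordinates \<open>c\<close> of \<open>y\<close>.\<close>
    define x where "x = K.of_coords (\<lambda>k. \<Sum>p\<in>?I. c p * conjugate (?u k p))"
    show x: "x \<in> carrier K" by (simp add: x_def)
    show "\<forall>j\<in>{1..m}. W j x = y j"
    proof
      fix j assume j: "j \<in> {1..m}"
      interpret onb_pair K L g "Hs j" "l j" "f j" by (rule pair[OF j])
      show "W j x = y j"
      proof (rule cod.eq_if_coord_eq[OF WC[OF j x] y[OF j]])
        fix i assume i: "i < l j"
        then have q: "(j, i) \<in> ?I" using j by simp
        have "inner_prod (Hs j) (W j x) (f j i) =
            (\<Sum>k<L. (\<Sum>p\<in>?I. c p * conjugate (?u k p)) * ?u k (j, i))"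
          using coord_op[OF W[OF j] x i] by (simp add: x_def K.coord_of_coords)
        also have "\<dots> = (\<Sum>p\<in>?I. c p * (\<Sum>k<L. ?u k (j, i) * conjugate (?u k p)))"
          unfolding sum_distrib_left sum_distrib_right by (subst sum.swap) (simp add: mult_ac)
        \<comment> \<open>Here the rows of the square matrix are orthonormal as well.\<close>
        also have "\<dots> = (\<Sum>p\<in>?I. if p = (j, i) then c p else 0)"
          using orthonormal_system_dual[OF fin u q] unfolding card by (intro sum.cong) auto
        also have "\<dots> = c (j, i)" using q fin by (simp add: sum.delta)
        finally show "inner_prod (Hs j) (W j x) (f j i) = inner_prod (Hs j) (y j) (f j i)"
          by (simp add: c_def)
      qed
    qed
  qed
  have zero: "\<zero>\<^bsub>Hs j\<^esub> \<in> carrier (Hs j)" if "j \<in> {1..m}" for j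
  proof -
    interpret onb_space "Hs j" "l j" "f j" by (rule Hs[OF that])
    show ?thesis by simp
  qed
  have "W j ` carrier K = carrier (Hs j)" if j: "j \<in> {1..m}" for j
  proof (intro equalityI subsetI)
    fix z assume z: "z \<in> carrier (Hs j)"
    \<comment> \<open>Surjectivity onto one block: prescribe \<open>z\<close> there and zero in all
      the others.\<close>
    have "\<exists>x\<in>carrier K. \<forall>j'\<in>{1..m}. W j' x = (if j' = j then z else \<zero>\<^bsub>Hs j'\<^esub>)"
      by (rule surj) (use z zero in auto)
    then show "z \<in> W j ` carrier K" using j by force
  qed (use WC j in auto)
  moreover have "analysis_op m W ` carrier K = (\<Pi>\<^sub>E j\<in>{1..m}. carrier (Hs j))"
  proof (intro equalityI subsetI)
    fix y assume y: "y \<in> (\<Pi>\<^sub>E j\<in>{1..m}. carrier (Hs j))"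
    obtain x where x: "x \<in> carrier K" "\<forall>j\<in>{1..m}. W j x = y j"
      using surj[of y] y by blast
    have "analysis_op m W x = y"
    proof
      \<comment> \<open>Outside \<open>{1..m}\<close> both functions are \<open>undefined\<close>,
        one by restriction and the other by extensionality.\<close>
      fix j show "analysis_op m W x j = y j"
        using x y by (cases "j \<in> {1..m}") (auto simp: analysis_op_def PiE_def extensional_def)
    qed
    then show "y \<in> analysis_op m W ` carrier K" using x by blast
  qed (use WC in \<open>auto simp: analysis_op_def\<close>)
  ultimately show ?thesis
    using parseval by (simp add: riesz_frame_def parseval_frame_def)
qed

section \<open>Block matrices and completion to an orthonormal frame\<close>

lemma
  assumes A: "A \<in> carrier_mat d n" and B: "B \<in> carrier_mat d n'"
  shows beside_carrier: "beside A B \<in> carrier_mat d (n + n')"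
    and index_beside: "i < d \<Longrightarrow> k < n + n' \<Longrightarrow>
      beside A B $$ (i, k) = (if k < n then A $$ (i, k) else B $$ (i, k - n))"
proof -
  have len: "length (cols A @ cols B) = n + n'" using A B by simp
  show "beside A B \<in> carrier_mat d (n + n')"
    unfolding beside_def using A B by (metis carrier_matD(1) len mat_of_cols_carrier(1))
  show "beside A B $$ (i, k) = (if k < n then A $$ (i, k) else B $$ (i, k - n))"
    if "i < d" "k < n + n'"
    using A B that by (auto simp: beside_def mat_of_cols_index nth_append)
qed

text \<open>\<open>K\<close> is the space of dimension \<open>L\<close> on which the block operators
  act. Subtraction of naturals is truncated, so the conjunct \<open>n \<le> L\<close> ensures that
  \<open>L - n\<close> is the true difference; from left to right it is proved.\<close>

theorem theorem7:
  fixes H :: "('k::real_or_complex, 'v) hilbert"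
    and Hs :: "nat \<Rightarrow> ('k, 'w) hilbert"
    and K :: "('k, 'u) hilbert"
    and n m L :: nat
    and l :: "nat \<Rightarrow> nat"
    and e :: "nat \<Rightarrow> 'v" and f :: "nat \<Rightarrow> nat \<Rightarrow> 'w" and g :: "nat \<Rightarrow> 'u"
    and V :: "nat \<Rightarrow> 'v \<Rightarrow> 'w"
  assumes "hilbert_space H" and "has_dim H n" and "orthonormal_basis H n e"
    and "\<And>j. j \<in> {1..m} \<Longrightarrow> hilbert_space (Hs j)"
    and "\<And>j. j \<in> {1..m} \<Longrightarrow> has_dim (Hs j) (l j)"
    and "\<And>j. j \<in> {1..m} \<Longrightarrow> orthonormal_basis (Hs j) (l j) (f j)"
    and "L = (\<Sum>j=1..m. l j)"
    and "hilbert_space K" and "has_dim K L" and "orthonormal_basis K L g"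
    and "\<And>j. j \<in> {1..m} \<Longrightarrow> V j \<in> bounded_ops H (Hs j)"
  shows "parseval_frame H m Hs V \<longleftrightarrow>
    (n \<le> L \<and>
     (\<exists>V' :: nat \<Rightarrow> 'k mat.
        (\<forall>j\<in>{1..m}. V' j \<in> carrier_mat (l j) (L - n)) \<and>
        orthonormal_frame K m Hs
          (\<lambda>j. op_of_mat K g (Hs j) (f j)
                 (beside (mat_of_op n e (Hs j) (l j) (f j) (V j)) (V' j)))))"
proof -
  have H: "onb_space H n e" and K: "onb_space K L g"
    using assms(1,3,8,10) by (simp_all add: onb_space_def onb_space_axioms_def)
  have Hs: "onb_space (Hs j) (l j) (f j)" if "j \<in> {1..m}" for j
    using assms(4,6)[OF that] by (simp add: onb_space_def onb_space_axioms_def)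
  interpret K: onb_space K L g by (rule K)
  have pair: "onb_pair K L g (Hs j) (l j) (f j)" if "j \<in> {1..m}" for j
    by (intro onb_pair.intro K Hs that)
  let ?I = "SIGMA j:{1..m}. {..<l j}"
  let ?u = "\<lambda>k (j, i). inner_prod (Hs j) (V j (e k)) (f j i)"
  have fin: "finite ?I" by simp
  have card: "card ?I = L" by (simp add: assms(7))
  define M where "M j = mat_of_op n e (Hs j) (l j) (f j) (V j)" for j
  have M: "M j \<in> carrier_mat (l j) n" for j by (simp add: M_def mat_of_op_def)
  define W where "W V' j = op_of_mat K g (Hs j) (f j) (beside (M j) (V' j))" for V' j
  \<comment> \<open>Column \<open>k\<close> of the stacked block matrices: first the columns of the
    given family, then those of \<open>V'\<close>, shifted by \<open>n\<close>.\<close>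
  define c where "c V' k = (\<lambda>(j, i). if k < n then ?u k (j, i) else V' j $$ (i, k - n))"
    for V' :: "nat \<Rightarrow> 'k mat" and k
  have parseval_V: "parseval_frame H m Hs V \<longleftrightarrow> orthonormal_system ?I n ?u"
    by (rule parseval_frame_iff[OF H Hs assms(11)])
  have orthonormal_W: "orthonormal_frame K m Hs (W V') \<longleftrightarrow> orthonormal_system ?I L (c V')"
    if n: "n \<le> L" and V': "\<And>j. j \<in> {1..m} \<Longrightarrow> V' j \<in> carrier_mat (l j) (L - n)" for V'
  proof -
    have U: "beside (M j) (V' j) \<in> carrier_mat (l j) L" if "j \<in> {1..m}" for j
      using beside_carrier[OF M V'[OF that]] n by simp
    have WB: "W V' j \<in> bounded_ops K (Hs j)" if "j \<in> {1..m}" for j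
      unfolding W_def by (rule onb_pair.op_of_mat_bounded[OF pair[OF that] U[OF that]])
    have "inner_prod (Hs j) (W V' j (g k)) (f j i) = c V' k (j, i)"
      if k: "k < L" and j: "j \<in> {1..m}" and i: "i < l j" for k j i
    proof -
      interpret onb_pair K L g "Hs j" "l j" "f j" by (rule pair[OF j])
      \<comment> \<open>The image of the basis vector \<open>g k\<close> is read off from column
        \<open>k\<close> of the block matrix.\<close>
      have "inner_prod (Hs j) (W V' j (g k)) (f j i) =
          (\<Sum>k'<L. if k = k' then beside (M j) (V' j) $$ (i, k') else 0)"
        unfolding W_def coord_op_of_mat[OF U[OF j] i]
        using k by (intro sum.cong) (auto simp: K.coord_basis)
      also have "\<dots> = beside (M j) (V' j) $$ (i, k)" using k by simp
      also have "\<dots> = c V' k (j, i)"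
        using index_beside[OF M V'[OF j] i, of k] k n i
        by (simp add: c_def M_def mat_of_op_def)
      finally show ?thesis .
    qed
    then have "orthonormal_system ?I L (\<lambda>k (j, i). inner_prod (Hs j) (W V' j (g k)) (f j i))
        \<longleftrightarrow> orthonormal_system ?I L (c V')"
      by (intro orthonormal_system_cong) auto
    \<comment> \<open>The stacked matrix is square, so the Riesz property comes with
      Parseval.\<close>
    moreover have "orthonormal_frame K m Hs (W V') \<longleftrightarrow> parseval_frame K m Hs (W V')"
      using riesz_frame_if_parseval[OF K[unfolded assms(7)] Hs WB]
      by (auto simp: orthonormal_frame_def)
    ultimately show ?thesis using parseval_frame_iff[OF K Hs WB] by simp
  qed
  have "orthonormal_system ?I n ?u \<longleftrightarrow> n \<le> L \<and>
    (\<exists>V'. (\<forall>j\<in>{1..m}. V' j \<in> carrier_mat (l j) (L - n)) \<and> orthonormal_frame K m Hs (W V'))"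
  proof
    assume u: "orthonormal_system ?I n ?u"
    have n: "n \<le> L" using orthonormal_system_card_le[OF fin u] unfolding card .
    obtain v where v: "orthonormal_system ?I L v" "\<forall>k<n. v k = ?u k"
      using orthonormal_system_extend[OF fin n _ u] unfolding card by blast
    \<comment> \<open>The columns \<open>n\<close>, ..., \<open>L - 1\<close> of the extended
      system, cut into blocks of rows.\<close>
    define V' where "V' j = mat (l j) (L - n) (\<lambda>(i, k). v (n + k) (j, i))" for j
    have "orthonormal_system ?I L (c V')"
      using v by (subst orthonormal_system_cong[where v = v]) (auto simp: c_def V'_def)
    then have "orthonormal_frame K m Hs (W V')"
      using orthonormal_W[OF n, of V'] by (simp add: V'_def)
    then show "n \<le> L \<and> (\<exists>V'. (\<forall>j\<in>{1..m}. V' j \<in> carrier_mat (l j) (L - n)) \<and>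
        orthonormal_frame K m Hs (W V'))"
      using n by (intro conjI exI[of _ V']) (auto simp: V'_def)
  next
    assume "n \<le> L \<and> (\<exists>V'. (\<forall>j\<in>{1..m}. V' j \<in> carrier_mat (l j) (L - n)) \<and>
        orthonormal_frame K m Hs (W V'))"
    then obtain V' where n: "n \<le> L" and V': "\<And>j. j \<in> {1..m} \<Longrightarrow> V' j \<in> carrier_mat (l j) (L - n)"
        and "orthonormal_frame K m Hs (W V')" by blast
    \<comment> \<open>Keep the first \<open>n\<close> columns, where \<open>c V'\<close> agrees with
      the columns of the given family.\<close>
    then have "orthonormal_system ?I n (c V')"
      using orthonormal_W[OF n V'] orthonormal_system_mono[OF _ n] by blast
    then show "orthonormal_system ?I n ?u"
      by (subst orthonormal_system_cong[where v = "c V'"]) (auto simp: c_def)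
  qed
  then show ?thesis unfolding parseval_V W_def[abs_def] M_def .
qed

end
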